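(* Let $k:\mathbb N\to\mathbb N$. Then the limiting probability, as $n\to\infty$, that in a uniformly random assignment of $n$ drivers to $n$ spaces at least $k(n)$ drivers fail to park is $$\lim_{n\to\infty}\frac{S(n,n,k(n))}{n^n}=\begin{cases}0 & \text{if }\lim_{n\to\infty}k(n)/\sqrt n=\infty,\\ 1 & \text{if }\lim_{n\to\infty}k(n)/\sqrt n=0.\end{cases}$$
   Context: Car parking problem: a car park has $n$ spaces in a line, numbered $1,\dots,n$, and $m$ drivers arrive one after the other. Each driver has chosen a preferred space, so an assignment is a function $f:\{1,\dots,m\}\to\{1,\dots,n\}$, and there are $n^m$ assignments; a random assignment is one chosen uniformly among these. Each arriving driver parks in the chosen space if it is free; otherwise the driver takes the first free space with a larger number, if there is one; if there is none, the driver fails to park and goes home. For $n,m,k\in\mathbb N_0$ define $$S(n,m,k)=\begin{cases} n^m & \text{if } k\le m-n,\\ \displaystyle\sum_{i=0}^{m-k}\binom{m}{i}\,(n-m+k)\,(n-m+k+i)^{i-1}\,(m-k-i)^{m-i} & \text{otherwise.}\end{cases}$$ Here $0^0=1$, and an empty sum (when $k>m$) is $0$. The number $S(n,m,k)$ is the number of assignments of $m$ drivers to $n$ spaces for which at least $k$ drivers fail to park. *)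

theory Defs
  imports "HOL-Probability.Probability"
begin

definition assignments :: "nat \<Rightarrow> nat \<Rightarrow> (nat \<Rightarrow> nat) set" where
  "assignments n m = {1..m} \<rightarrow>\<^sub>E {1..n}"

definition parking_space :: "nat \<Rightarrow> nat set \<Rightarrow> nat \<Rightarrow> nat option" where
  "parking_space n occ p =
     (if p \<notin> occ then Some p
      else if \<exists>s. p < s \<and> s \<le> n \<and> s \<notin> occ
        then Some (LEAST s. p < s \<and> s \<le> n \<and> s \<notin> occ)
      else None)"

text \<open>\<open>occupied n f j\<close> is the set of spaces taken once drivers \<open>1, \<dots>, j\<close> have arrived.\<close>

primrec occupied :: "nat \<Rightarrow> (nat \<Rightarrow> nat) \<Rightarrow> nat \<Rightarrow> nat set" where
  "occupied n f 0 = {}"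
| "occupied n f (Suc j) =
     occupied n f j \<union> set_option (parking_space n (occupied n f j) (f (Suc j)))"

definition failing_drivers :: "nat \<Rightarrow> nat \<Rightarrow> (nat \<Rightarrow> nat) \<Rightarrow> nat set" where
  "failing_drivers n m f =
     {j \<in> {1..m}. parking_space n (occupied n f (j - 1)) (f j) = None}"

definition prob_at_least_fail :: "nat \<Rightarrow> nat \<Rightarrow> nat \<Rightarrow> real" where
  "prob_at_least_fail n m k =
     measure_pmf.prob (pmf_of_set (assignments n m)) {f. k \<le> card (failing_drivers n m f)}"

text \<open>The condition \<open>k + n \<le> m\<close> and the range \<open>i + k \<le> m\<close> express \<open>k \<le> m - n\<close> and
  \<open>0 \<le> i \<le> m - k\<close> with integer rather than truncated subtraction; in particular the sum is
  empty when \<open>k > m\<close>. The exponent \<open>i - 1\<close> is \<open>-1\<close> for \<open>i = 0\<close>, with a positive base since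
  \<open>n - m + k > 0\<close> in the second case.\<close>

definition S :: "nat \<Rightarrow> nat \<Rightarrow> nat \<Rightarrow> real" where
  "S n m k =
     (if k + n \<le> m then real n ^ m
      else (\<Sum>i | i + k \<le> m.
              real (m choose i) * (real n - real m + real k)
              * (real n - real m + real k + real i) powi (int i - 1)
              * (real m - real k - real i) ^ (m - i)))"

end

theory Submission
  imports Defs
begin

text \<open>
  Write \<open>N\<^sub>t\<close> for the number of drivers who prefer one of the spaces \<open>1, \<dots>, t\<close>. At least
  \<open>k > 0\<close> drivers fail exactly when the walk \<open>t - N\<^sub>t\<close> reaches the level \<open>k\<close>: only \<open>n - t\<close>
  of the drivers who prefer a space beyond \<open>t\<close> find room there, and if \<open>t\<close> is the last space
  left free, then nobody ever passes \<open>t\<close>, so the drivers who prefer a space beyond \<open>t\<close> are those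
  who fill the spaces beyond \<open>t\<close> and those who fail (\<open>at_least_fail_iff_crossing\<close>).

  The walk moves up by at most one, so it hits \<open>k\<close> before it can exceed \<open>k\<close>. If this
  happens first at \<open>t = k + i\<close>, then \<open>i\<close> drivers prefer a space up to \<open>t\<close>, their preferences
  form an assignment that reaches \<open>k\<close> only at its end, and the other drivers choose freely among
  the remaining spaces (\<open>card_crossing\<close>). Assignments of the first kind number
  \<open>k (k + i)\<^sup>i\<^sup>-\<^sup>1\<close>: with \<open>m\<close> drivers and \<open>m + k\<close> spaces every assignment reaches
  \<open>k\<close>, so the decomposition becomes a recursion for these numbers, and Abel's binomial identity says
  that \<open>k (k + i)\<^sup>i\<^sup>-\<^sup>1\<close> solves it (\<open>card_late_crossing\<close>). Hence the probability in question is
  \<open>S n n k / n\<^sup>n\<close>.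

  The asymptotics then need only two estimates of the sum. Both rest on the bound
  \<open>binomial_mode_le\<close> for the largest weight of a binomial distribution, which has the order of
  one over the standard deviation.

  From above, the summand with index \<open>i > 0\<close> is this weight times
  \<open>k / (k + i) (1 + k/i)\<^sup>i (1 - k/(n-i))\<^sup>n\<^sup>-\<^sup>i\<close>. The last two factors multiply to at most
  \<open>exp (- k\<^sup>2 / (2 (i + k)))\<close>, and \<open>exp (- u) \<le> 1 / u\<close> turns the whole into \<open>2 / k\<close> times the
  weight. Summing the weights gives a bound of order \<open>\<surd>n / k\<close>.

  From below, let \<open>m = n - k\<close>. By Abel's identity the numbers
  \<open>(m choose i) k (k + i)\<^sup>i\<^sup>-\<^sup>1 (m - i)\<^sup>m\<^sup>-\<^sup>i / n\<^sup>m\<close> for \<open>i \<le> m\<close> add up to \<open>1\<close>; they are the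
  distribution of the first hitting time when there are \<open>m\<close> drivers only. For \<open>i \<le> n / 2\<close> the
  summands of \<open>S n n k / n\<^sup>n\<close> are at least \<open>1 - 2 k\<^sup>2 / n\<close> times as large, and the part with
  \<open>i > n / 2\<close> has total mass of order \<open>k / \<surd>n\<close>. So the probability is at least
  \<open>1 - O (k / \<surd>n)\<close> whenever \<open>k \<le> \<surd>n\<close>.
\<close>

section \<open>Failures and level crossings\<close>

definition num_below :: "('a \<Rightarrow> nat) \<Rightarrow> 'a set \<Rightarrow> nat \<Rightarrow> nat" where
  "num_below f A s = card {a \<in> A. f a \<le> s}"

lemma finite_occupied: "finite (occupied n f j)"
  by (induction j) auto

lemma parking_space_SomeD:
  assumes "parking_space n occ p = Some s" "p \<in> {1..n}"
  shows "s \<notin> occ" "p \<le> s" "s \<le> n" "\<And>t. p \<le> t \<Longrightarrow> t \<le> n \<Longrightarrow> t \<notin> occ \<Longrightarrow> s \<le> t"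
proof -
  let ?Q = "\<lambda>s. p < s \<and> s \<le> n \<and> s \<notin> occ"
  have "s \<notin> occ \<and> p \<le> s \<and> s \<le> n \<and> (\<forall>t. p \<le> t \<longrightarrow> t \<le> n \<longrightarrow> t \<notin> occ \<longrightarrow> s \<le> t)"
  proof (cases "p \<in> occ")
    case True
    with assms have ex: "\<exists>s. ?Q s" and s: "s = (LEAST s. ?Q s)"
      by (auto simp: parking_space_def split: if_splits)
    from LeastI_ex[OF ex] have "?Q s" unfolding s .
    moreover have "s \<le> t" if "p \<le> t" "t \<le> n" "t \<notin> occ" for t
      unfolding s using that True by (intro Least_le) (auto simp: le_less)
    ultimately show ?thesis by auto
  next
    case False
    with assms show ?thesis by (auto simp: parking_space_def)
  qed
  then show "s \<notin> occ" "p \<le> s" "s \<le> n" "\<And>t. p \<le> t \<Longrightarrow> t \<le> n \<Longrightarrow> t \<notin> occ \<Longrightarrow> s \<le> t"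
    by auto
qed

lemma parking_space_NoneD:
  assumes "parking_space n occ p = None" "p \<le> t" "t \<le> n"
  shows "t \<in> occ"
  using assms by (auto simp: parking_space_def le_less split: if_splits)

lemma occupied_subset:
  assumes "\<And>i. i \<in> {1..j} \<Longrightarrow> f i \<in> {1..n}"
  shows "occupied n f j \<subseteq> {1..n}"
  using assms
proof (induction j)
  case (Suc j)
  have "s \<in> {1..n}" if "parking_space n (occupied n f j) (f (Suc j)) = Some s" for s
    using parking_space_SomeD(2,3)[OF that] Suc.prems[of "Suc j"] by fastforce
  moreover have "occupied n f j \<subseteq> {1..n}"
    using Suc by force
  ultimately show ?case
    by (auto simp del: atLeastAtMost_iff)
qed auto

lemma failing_drivers_Suc:
  "failing_drivers n (Suc j) f = failing_drivers n j f \<union>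
     (if parking_space n (occupied n f j) (f (Suc j)) = None then {Suc j} else {})"
  by (auto simp: failing_drivers_def le_Suc_eq)

lemma card_failing_drivers_Suc:
  "card (failing_drivers n (Suc j) f) = card (failing_drivers n j f) +
     (if parking_space n (occupied n f j) (f (Suc j)) = None then 1 else 0)"
proof -
  have "finite (failing_drivers n j f)" "Suc j \<notin> failing_drivers n j f"
    by (auto simp: failing_drivers_def)
  then show ?thesis
    by (simp add: failing_drivers_Suc)
qed

lemma card_preferences_above_Suc:
  "card {i \<in> {1..Suc j}. t < f i} = card {i \<in> {1..j}. t < f i} + (if t < f (Suc j) then 1 else (0::nat))"
proof -
  have "{i \<in> {1..Suc j}. t < f i} = {i \<in> {1..j}. t < f i} \<union> (if t < f (Suc j) then {Suc j} else {})"
    by (auto simp: le_Suc_eq)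
  then show ?thesis by simp
qed

lemma card_occupied_above_Suc:
  "card (occupied n f (Suc j) \<inter> {t<..}) \<le> card (occupied n f j \<inter> {t<..}) +
     (case parking_space n (occupied n f j) (f (Suc j)) of None \<Rightarrow> 0 | Some s \<Rightarrow> if t < s then 1 else 0)"
proof (cases "parking_space n (occupied n f j) (f (Suc j))")
  case (Some s)
  have "occupied n f (Suc j) \<inter> {t<..} =
        occupied n f j \<inter> {t<..} \<union> (if t < s then {s} else {})"
    using Some by auto
  moreover have "card (occupied n f j \<inter> {t<..} \<union> (if t < s then {s} else {}))
     \<le> card (occupied n f j \<inter> {t<..}) + card (if t < s then {s} else {})"
    by (rule card_Un_le)
  ultimately show ?thesis using Some by (auto split: if_splits)
qed simp

text \<open>
  A driver who prefers a space beyond \<open>t\<close> either fails or takes a new space beyond \<open>t\<close>, so each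
  arrival preserves this bound.
\<close>
lemma preferences_above_le:
  assumes "\<And>i. i \<in> {1..j} \<Longrightarrow> f i \<in> {1..n}"
  shows "card {i \<in> {1..j}. t < f i} \<le> card (occupied n f j \<inter> {t<..}) + card (failing_drivers n j f)"
  using assms
proof (induction j)
  case (Suc j)
  have IH: "card {i \<in> {1..j}. t < f i} \<le> card (occupied n f j \<inter> {t<..}) + card (failing_drivers n j f)"
    using Suc by force
  have fin: "finite (occupied n f j \<inter> {t<..})" by (simp add: finite_occupied)
  show ?case
  proof (cases "parking_space n (occupied n f j) (f (Suc j))")
    case None
    then show ?thesis using IH
      unfolding card_failing_drivers_Suc card_preferences_above_Suc by simp
  next
    case (Some s)
    from parking_space_SomeD[OF Some] Suc.prems[of "Suc j"]
    have s: "s \<notin> occupied n f j" "f (Suc j) \<le> s" by auto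
    have "occupied n f (Suc j) \<inter> {t<..} =
        (if t < s then insert s (occupied n f j \<inter> {t<..}) else occupied n f j \<inter> {t<..})"
      using Some by auto
    then have "card (occupied n f (Suc j) \<inter> {t<..}) =
        card (occupied n f j \<inter> {t<..}) + (if t < s then 1 else 0)"
      using s fin by simp
    then show ?thesis using IH s Some
      unfolding card_failing_drivers_Suc card_preferences_above_Suc
      by (auto split: if_splits)
  qed
qed simp

text \<open>
  A driver who prefers a space up to the free space \<open>t\<close> parks at \<open>t\<close> or before it, and hence
  neither fails nor takes a space beyond \<open>t\<close>. The value \<open>t = 0\<close> is allowed and stands for a car park
  with no free space.
\<close>
lemma preferences_above_ge:
  assumes "\<And>i. i \<in> {1..j} \<Longrightarrow> f i \<in> {1..n}" "t \<notin> occupied n f j" "t \<le> n"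
  shows "card (occupied n f j \<inter> {t<..}) + card (failing_drivers n j f) \<le> card {i \<in> {1..j}. t < f i}"
  using assms
proof (induction j)
  case (Suc j)
  have IH: "card (occupied n f j \<inter> {t<..}) + card (failing_drivers n j f) \<le> card {i \<in> {1..j}. t < f i}"
    using Suc by force
  have t: "t \<notin> occupied n f j" using Suc.prems by auto
  show ?case
  proof (cases "parking_space n (occupied n f j) (f (Suc j))")
    case None
    have "t < f (Suc j)" using parking_space_NoneD[OF None] t Suc.prems(3) by (meson not_le)
    then show ?thesis using IH None
      unfolding card_failing_drivers_Suc card_preferences_above_Suc by simp
  next
    case (Some s)
    have fs: "f (Suc j) \<in> {1..n}" using Suc.prems(1) by simp
    from parking_space_SomeD(4)[OF Some fs, of t] t Suc.prems(3)
    have "t < s \<longrightarrow> t < f (Suc j)" by force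
    then show ?thesis using IH Some card_occupied_above_Suc[of n f j t]
      unfolding card_failing_drivers_Suc card_preferences_above_Suc
      by (auto split: if_splits)
  qed
qed (simp add: failing_drivers_def)

lemma at_least_fail_iff_crossing:
  assumes f: "f \<in> assignments n n" and k: "k > 0"
  shows "k \<le> card (failing_drivers n n f) \<longleftrightarrow> (\<exists>t\<le>n. num_below f {1..n} t + k \<le> t)"
proof -
  have f': "f i \<in> {1..n}" if "i \<in> {1..n}" for i
    using f that by (auto simp: assignments_def)
  have occ: "occupied n f n \<subseteq> {1..n}" by (rule occupied_subset) (fact f')
  have split: "num_below f {1..n} t + card {i \<in> {1..n}. t < f i} = n" for t
  proof -
    have "card ({i \<in> {1..n}. f i \<le> t} \<union> {i \<in> {1..n}. t < f i}) =
          card {i \<in> {1..n}. f i \<le> t} + card {i \<in> {1..n}. t < f i}"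
      by (rule card_Un_disjoint) auto
    moreover have "{i \<in> {1..n}. f i \<le> t} \<union> {i \<in> {1..n}. t < f i} = {1..n}" by auto
    ultimately show ?thesis by (simp add: num_below_def)
  qed
  show ?thesis
  proof
    assume k': "k \<le> card (failing_drivers n n f)"
    \<comment> \<open>The witness is the last space left free, or \<open>0\<close> if the car park is full.\<close>
    define E where "E = insert 0 ({1..n} - occupied n f n)"
    define t where "t = Max E"
    have "finite E" "E \<noteq> {}" by (auto simp: E_def)
    then have "t \<in> E" and max: "\<And>s. s \<in> E \<Longrightarrow> s \<le> t"
      unfolding t_def by simp_all
    then have t: "t \<le> n" "t \<notin> occupied n f n"
      using occ by (auto simp: E_def)
    have "{t<..n} \<subseteq> occupied n f n \<inter> {t<..}"
      using max by (force simp: E_def)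
    then have "n - t \<le> card (occupied n f n \<inter> {t<..})"
      using card_mono[of "occupied n f n \<inter> {t<..}" "{t<..n}"] by (simp add: finite_occupied)
    then have "num_below f {1..n} t + k \<le> t"
      using preferences_above_ge[of n f n t, OF f' t(2,1)] split[of t] k' t(1) by linarith
    with t show "\<exists>t\<le>n. num_below f {1..n} t + k \<le> t" by blast
  next
    assume "\<exists>t\<le>n. num_below f {1..n} t + k \<le> t"
    then obtain t where t: "t \<le> n" "num_below f {1..n} t + k \<le> t" by blast
    have "card (occupied n f n \<inter> {t<..}) \<le> card {t<..n}"
      using occ by (intro card_mono) auto
    then have "card (occupied n f n \<inter> {t<..}) \<le> n - t" by simp
    then show "k \<le> card (failing_drivers n n f)"
      using preferences_above_le[of n f n t, OF f'] split[of t] t by linarith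
  qed
qed

section \<open>Abel's binomial identity\<close>

text \<open>
  This is \<open>x (x + i)\<^sup>i\<^sup>-\<^sup>1\<close>. The case \<open>i = 0\<close> is set to \<open>1\<close>, so that the weights are polynomials in
  \<open>x\<close> and Abel's identity also holds at \<open>x = 0\<close>.
\<close>
definition abel_weight :: "real \<Rightarrow> nat \<Rightarrow> real" where
  "abel_weight x i = (if i = 0 then 1 else x * (x + real i) ^ (i - 1))"

text \<open>
  The sum is an \<open>m\<close>-fold finite difference of a polynomial of degree \<open>j < m\<close>. One difference
  suffices to go from \<open>m\<close> to \<open>m + 1\<close>. In the new case \<open>j = m\<close> the \<open>m\<close>-fold difference is no
  longer zero, but its derivative is, so it is constant and the additional difference removes it.
\<close>
lemma alternating_binomial_power_sum:
  fixes x :: real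
  assumes "j < m"
  shows "(\<Sum>i\<le>m. (-1) ^ (m - i) * real (m choose i) * (x + real i) ^ j) = 0"
  using assms
proof (induction m arbitrary: x j)
  case (Suc m)
  let ?D = "\<lambda>m j x. \<Sum>i\<le>m. (-1) ^ (m - i) * real (m choose i) * (x + real i) ^ j"
  have rec: "?D (Suc m) j x = ?D m j (x + 1) - ?D m j x" for j x
  proof -
    have "?D (Suc m) j x = (-1) ^ Suc m * x ^ j +
        (\<Sum>i\<le>m. (-1) ^ (m - i) * real (Suc m choose Suc i) * (x + real (Suc i)) ^ j)"
      by (subst sum.atMost_Suc_shift) simp
    also have "(\<Sum>i\<le>m. (-1) ^ (m - i) * real (Suc m choose Suc i) * (x + real (Suc i)) ^ j) =
        ?D m j (x + 1) + (\<Sum>i\<le>m. (-1) ^ (m - i) * real (m choose Suc i) * (x + real (Suc i)) ^ j)"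
      by (simp add: sum.distrib[symmetric] algebra_simps)
    also have "(-1) ^ Suc m * x ^ j + (?D m j (x + 1) +
        (\<Sum>i\<le>m. (-1) ^ (m - i) * real (m choose Suc i) * (x + real (Suc i)) ^ j)) =
        ?D m j (x + 1) + (\<Sum>i\<le>Suc m. (-1) ^ (Suc m - i) * real (m choose i) * (x + real i) ^ j)"
      by (subst sum.atMost_Suc_shift) simp
    also have "(\<Sum>i\<le>Suc m. (-1) ^ (Suc m - i) * real (m choose i) * (x + real i) ^ j) =
        (\<Sum>i\<le>m. (-1) ^ (Suc m - i) * real (m choose i) * (x + real i) ^ j)"
      by simp
    also have "\<dots> = - ?D m j x"
      by (subst sum_negf[symmetric], rule sum.cong) (auto simp: Suc_diff_le)
    finally show ?thesis by simp
  qed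
  show ?case
  proof (cases "j < m")
    case True
    then show ?thesis using Suc.IH[of j] by (simp only: rec)
  next
    case False
    then have jm: "j = m" using Suc.prems by simp
    have const: "?D m m y = ?D m m 0" for y
    proof (rule DERIV_isconst_all[where f = "\<lambda>y. ?D m m y"])
      show "\<forall>y. ((\<lambda>y. ?D m m y) has_real_derivative 0) (at y)"
      proof
        fix y :: real
        have "(\<Sum>i\<le>m. (-1) ^ (m - i) * real (m choose i) * (real m * (y + real i) ^ (m - 1)))
            = real m * ?D m (m - 1) y"
          by (simp add: sum_distrib_left mult_ac)
        also have "\<dots> = 0"
          using Suc.IH[of "m - 1" y] by (cases "m = 0") auto
        finally have z: "(\<Sum>i\<le>m. (-1) ^ (m - i) * real (m choose i) * (real m * (y + real i) ^ (m - 1))) = 0" .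
        have "((\<lambda>y. ?D m m y) has_real_derivative
            (\<Sum>i\<le>m. (-1) ^ (m - i) * real (m choose i) * (real m * (y + real i) ^ (m - 1)))) (at y)"
        proof (rule DERIV_sum)
          fix i
          show "((\<lambda>y. (-1) ^ (m - i) * real (m choose i) * (y + real i) ^ m) has_real_derivative
              (-1) ^ (m - i) * real (m choose i) * (real m * (y + real i) ^ (m - 1))) (at y)"
            by (rule derivative_eq_intros refl | simp)+
        qed
        then show "((\<lambda>y. ?D m m y) has_real_derivative 0) (at y)"
          unfolding z .
      qed
    qed
    show ?thesis unfolding jm rec using const[of "x + 1"] const[of x] by simp
  qed
qed simp

text \<open>
  For fixed \<open>x\<close> the derivatives of both sides with respect to \<open>y\<close> agree by the identity for
  \<open>m - 1\<close>. At \<open>y = - x\<close> and for \<open>m > 0\<close> the right-hand side vanishes, and the left-hand side is \<open>x\<close> times an alternating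
  binomial sum of powers with exponent \<open>m - 1\<close>.
\<close>
theorem Abel_binomial:
  fixes x y :: real
  shows "(\<Sum>i\<le>m. real (m choose i) * abel_weight x i * (y - real i) ^ (m - i)) = (x + y) ^ m"
proof (induction m arbitrary: y)
  case 0
  then show ?case by (simp add: abel_weight_def)
next
  case (Suc m)
  let ?A = "\<lambda>m y. \<Sum>i\<le>m. real (m choose i) * abel_weight x i * (y - real i) ^ (m - i)"
  have const: "?A (Suc m) y - (x + y) ^ Suc m = ?A (Suc m) (-x) - (x + - x) ^ Suc m" for y
  proof (rule DERIV_isconst_all[where f = "\<lambda>y. ?A (Suc m) y - (x + y) ^ Suc m"])
    show "\<forall>y. ((\<lambda>y. ?A (Suc m) y - (x + y) ^ Suc m) has_real_derivative 0) (at y)"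
    proof
      fix y :: real
      have absorb: "real (Suc m choose i) * real (Suc m - i) = real (Suc m) * real (m choose i)" for i
        using binomial_absorb_comp[of "Suc m" i] unfolding of_nat_mult[symmetric]
        by (simp only: diff_Suc_1 mult.commute)
      have "(\<Sum>i\<le>Suc m. real (Suc m choose i) * abel_weight x i * (real (Suc m - i) * (y - real i) ^ (Suc m - i - 1)))
          = (\<Sum>i\<le>Suc m. real (Suc m) * (real (m choose i) * abel_weight x i * (y - real i) ^ (m - i)))"
      proof (rule sum.cong)
        fix i
        have "real (Suc m choose i) * abel_weight x i * (real (Suc m - i) * (y - real i) ^ (Suc m - i - 1))
            = (real (Suc m choose i) * real (Suc m - i)) * abel_weight x i * (y - real i) ^ (m - i)"
          by simp
        then show "real (Suc m choose i) * abel_weight x i * (real (Suc m - i) * (y - real i) ^ (Suc m - i - 1))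
            = real (Suc m) * (real (m choose i) * abel_weight x i * (y - real i) ^ (m - i))"
          unfolding absorb by simp
      qed simp
      also have "\<dots> = real (Suc m) * (x + y) ^ m"
        using Suc.IH[of y] by (simp add: sum_distrib_left[symmetric])
      finally have e: "(\<Sum>i\<le>Suc m. real (Suc m choose i) * abel_weight x i *
          (real (Suc m - i) * (y - real i) ^ (Suc m - i - 1))) = real (Suc m) * (x + y) ^ m" .
      have "((\<lambda>y. ?A (Suc m) y) has_real_derivative (\<Sum>i\<le>Suc m. real (Suc m choose i) * abel_weight x i *
          (real (Suc m - i) * (y - real i) ^ (Suc m - i - 1)))) (at y)"
      proof (rule DERIV_sum)
        fix i
        show "((\<lambda>y. real (Suc m choose i) * abel_weight x i * (y - real i) ^ (Suc m - i)) has_real_derivative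
            real (Suc m choose i) * abel_weight x i * (real (Suc m - i) * (y - real i) ^ (Suc m - i - 1))) (at y)"
          by (rule derivative_eq_intros refl | simp)+
      qed
      moreover have "((\<lambda>y. (x + y) ^ Suc m) has_real_derivative real (Suc m) * (x + y) ^ m) (at y)"
        by (rule derivative_eq_intros refl | simp)+
      ultimately have "((\<lambda>y. ?A (Suc m) y - (x + y) ^ Suc m) has_real_derivative
          real (Suc m) * (x + y) ^ m - real (Suc m) * (x + y) ^ m) (at y)"
        unfolding e by (rule DERIV_diff)
      then show "((\<lambda>y. ?A (Suc m) y - (x + y) ^ Suc m) has_real_derivative 0) (at y)"
        unfolding diff_self .
    qed
  qed
  have "?A (Suc m) (-x) = (\<Sum>i\<le>Suc m. x * ((-1) ^ (Suc m - i) * real (Suc m choose i) * (x + real i) ^ m))"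
  proof (rule sum.cong)
    fix i assume i: "i \<in> {..Suc m}"
    have weight: "abel_weight x i * (x + real i) ^ (Suc m - i) = x * (x + real i) ^ m"
    proof (cases "i = 0")
      case False
      then have "i - 1 + (Suc m - i) = m" using i by auto
      then show ?thesis using False
        by (simp add: abel_weight_def mult.assoc power_add[symmetric])
    qed (simp add: abel_weight_def)
    have "(- x - real i) ^ (Suc m - i) = (-1) ^ (Suc m - i) * (x + real i) ^ (Suc m - i)"
      unfolding power_mult_distrib[symmetric] by simp
    then have "real (Suc m choose i) * abel_weight x i * (- x - real i) ^ (Suc m - i)
        = real (Suc m choose i) * (-1) ^ (Suc m - i) * (abel_weight x i * (x + real i) ^ (Suc m - i))"
      by (simp only: mult_ac)
    then show "real (Suc m choose i) * abel_weight x i * (- x - real i) ^ (Suc m - i)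
        = x * ((-1) ^ (Suc m - i) * real (Suc m choose i) * (x + real i) ^ m)"
      unfolding weight by (simp only: mult_ac)
  qed simp
  also have "\<dots> = 0"
    using alternating_binomial_power_sum[of m "Suc m" x]
    by (simp only: sum_distrib_left[symmetric])
  finally show ?case using const[of y] by simp
qed

section \<open>Counting assignments by the first crossing\<close>

text \<open>
  Here \<open>s - num_below g A s\<close> stays below \<open>k\<close> for all \<open>s < k + card A\<close>; it equals \<open>k\<close> at
  \<open>s = k + card A\<close>, where every preference has been counted. For \<open>k > 0\<close> these are the assignments for
  which all drivers could park in \<open>k + card A - 1\<close> spaces, which for \<open>k = 1\<close> are the parking functions.
\<close>
definition late_crossing :: "nat \<Rightarrow> 'a set \<Rightarrow> ('a \<Rightarrow> nat) set" where
  "late_crossing k A = {g \<in> A \<rightarrow>\<^sub>E {1..k + card A}. \<forall>s<k + card A. s < num_below g A s + k}"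

lemma num_below_mono: "finite A \<Longrightarrow> s \<le> t \<Longrightarrow> num_below f A s \<le> num_below f A t"
  unfolding num_below_def by (rule card_mono) auto

lemma num_below_le: "finite A \<Longrightarrow> num_below f A s \<le> card A"
  unfolding num_below_def by (rule card_mono) auto

lemma sum_subsets_by_card:
  fixes g :: "nat \<Rightarrow> real"
  assumes "finite A"
  shows "(\<Sum>I | I \<subseteq> A \<and> P (card I). g (card I)) = (\<Sum>i | i \<le> card A \<and> P i. real (card A choose i) * g i)"
proof -
  have "(\<Sum>I | I \<subseteq> A \<and> P (card I). g (card I)) =
      (\<Sum>i | i \<le> card A \<and> P i. \<Sum>I | I \<in> {I. I \<subseteq> A \<and> P (card I)} \<and> card I = i. g (card I))"
    using assms by (intro sum.group[symmetric]) (auto intro: card_mono)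
  also have "\<dots> = (\<Sum>i | i \<le> card A \<and> P i. real (card A choose i) * g i)"
  proof (rule sum.cong)
    fix i assume "i \<in> {i. i \<le> card A \<and> P i}"
    then have "{I. I \<in> {I. I \<subseteq> A \<and> P (card I)} \<and> card I = i} = {I. I \<subseteq> A \<and> card I = i}" by auto
    then show "(\<Sum>I | I \<in> {I. I \<subseteq> A \<and> P (card I)} \<and> card I = i. g (card I)) = real (card A choose i) * g i"
      using n_subsets[OF assms, of i] by simp
  qed simp
  finally show ?thesis .
qed

text \<open>
  If \<open>I\<close> is the set of drivers counted at the first crossing, then the preferences of \<open>I\<close> and
  those of the remaining drivers can be chosen independently.
\<close>
lemma card_first_crossing:
  fixes A :: "'a set"
  assumes fin: "finite A" and IA: "I \<subseteq> A" and IN: "card I + k \<le> N"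
  shows "card {f \<in> A \<rightarrow>\<^sub>E {1..N}. {a \<in> A. f a \<le> k + card I} = I \<and> restrict f I \<in> late_crossing k I} =
         card (late_crossing k I) * (N - k - card I) ^ (card A - card I)"
proof -
  let ?t = "k + card I"
  let ?B = "{f \<in> A \<rightarrow>\<^sub>E {1..N}. {a \<in> A. f a \<le> ?t} = I \<and> restrict f I \<in> late_crossing k I}"
  let ?R = "(A - I) \<rightarrow>\<^sub>E {?t + 1..N}"
  have finI: "finite I" using fin IA by (rule finite_subset[rotated])
  have "bij_betw (\<lambda>f. (restrict f I, restrict f (A - I))) ?B (late_crossing k I \<times> ?R)"
  proof (rule bij_betw_byWitness[where f' = "\<lambda>(g, h) a. if a \<in> I then g a else h a"])
    show "\<forall>f\<in>?B. (\<lambda>(g, h) a. if a \<in> I then g a else h a) (restrict f I, restrict f (A - I)) = f"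
    proof (intro ballI ext)
      fix f a assume "f \<in> ?B"
      then have "a \<notin> A \<Longrightarrow> f a = undefined" by (auto dest: PiE_arb)
      then show "(\<lambda>(g, h) a. if a \<in> I then g a else h a) (restrict f I, restrict f (A - I)) a = f a"
        by (cases "a \<in> A") auto
    qed
    show "\<forall>p\<in>late_crossing k I \<times> ?R. (\<lambda>f. (restrict f I, restrict f (A - I)))
        ((\<lambda>(g, h) a. if a \<in> I then g a else h a) p) = p"
    proof
      fix p assume "p \<in> late_crossing k I \<times> ?R"
      then obtain g h where p: "p = (g, h)" and "g \<in> I \<rightarrow>\<^sub>E {1..?t}" "h \<in> ?R"
        by (auto simp: late_crossing_def)
      then have "a \<notin> I \<Longrightarrow> g a = undefined" "a \<notin> A - I \<Longrightarrow> h a = undefined" for a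
        using PiE_arb by metis+
      then have "restrict (\<lambda>a. if a \<in> I then g a else h a) I = g"
        "restrict (\<lambda>a. if a \<in> I then g a else h a) (A - I) = h"
        by (auto simp: restrict_def fun_eq_iff)
      then show "(\<lambda>f. (restrict f I, restrict f (A - I))) ((\<lambda>(g, h) a. if a \<in> I then g a else h a) p) = p"
        by (simp add: p)
    qed
    show "(\<lambda>f. (restrict f I, restrict f (A - I))) ` ?B \<subseteq> late_crossing k I \<times> ?R"
    proof
      fix p assume "p \<in> (\<lambda>f. (restrict f I, restrict f (A - I))) ` ?B"
      then obtain f where f: "f \<in> A \<rightarrow>\<^sub>E {1..N}" "{a \<in> A. f a \<le> ?t} = I" "restrict f I \<in> late_crossing k I"
        and p: "p = (restrict f I, restrict f (A - I))" by blast
      have "f a \<in> {?t + 1..N}" if "a \<in> A - I" for a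
      proof -
        have "\<not> f a \<le> ?t" using f(2) that by blast
        moreover have "f a \<le> N" using f(1) that by (auto dest: PiE_mem)
        ultimately show ?thesis by simp
      qed
      then have "restrict f (A - I) \<in> ?R"
        by (simp add: restrict_PiE_iff)
      then show "p \<in> late_crossing k I \<times> ?R" using f(3) p by simp
    qed
    show "(\<lambda>(g, h) a. if a \<in> I then g a else h a) ` (late_crossing k I \<times> ?R) \<subseteq> ?B"
    proof
      fix f assume "f \<in> (\<lambda>(g, h) a. if a \<in> I then g a else h a) ` (late_crossing k I \<times> ?R)"
      then obtain g h where g: "g \<in> late_crossing k I" and h: "h \<in> ?R"
        and f: "f = (\<lambda>a. if a \<in> I then g a else h a)" by auto
      have g': "g \<in> I \<rightarrow>\<^sub>E {1..?t}" using g by (simp add: late_crossing_def)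
      have gI: "g a \<in> {1..?t}" if "a \<in> I" for a using g' that by (rule PiE_mem)
      have hI: "h a \<in> {?t + 1..N}" if "a \<in> A - I" for a using h that by (rule PiE_mem)
      have "f \<in> A \<rightarrow>\<^sub>E {1..N}"
      proof (rule PiE_I)
        fix a assume "a \<in> A"
        then show "f a \<in> {1..N}" using gI[of a] hI[of a] IN by (auto simp: f)
      next
        fix a assume "a \<notin> A"
        then show "f a = undefined" using IA PiE_arb[OF h, of a] by (auto simp: f)
      qed
      moreover have "{a \<in> A. f a \<le> ?t} = I"
      proof (intro equalityI subsetI)
        fix a assume "a \<in> {a \<in> A. f a \<le> ?t}"
        then show "a \<in> I" using hI[of a] by (auto simp: f split: if_splits)
      next
        fix a assume "a \<in> I"
        then show "a \<in> {a \<in> A. f a \<le> ?t}" using gI[of a] IA by (auto simp: f)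
      qed
      moreover have "restrict f I = g"
        using PiE_arb[OF g'] by (auto simp: f fun_eq_iff)
      ultimately show "f \<in> ?B" using g by simp
    qed
  qed
  then have "card ?B = card (late_crossing k I \<times> ?R)" by (rule bij_betw_same_card)
  also have "card ?R = (N - k - card I) ^ (card A - card I)"
    using fin finI IA by (simp add: card_PiE card_Diff_subset)
  then have "card (late_crossing k I \<times> ?R) = card (late_crossing k I) * (N - k - card I) ^ (card A - card I)"
    by (simp add: card_cartesian_product)
  finally show ?thesis .
qed

text \<open>
  Since \<open>t - num_below f A t\<close> grows by at most one per step and starts at \<open>0 < k\<close>, its first
  value that is at least \<open>k\<close> equals \<open>k\<close>. The first crossing thus happens at \<open>k + card I\<close>, where \<open>I\<close>
  is the set of drivers counted by then, and the assignments are classified by \<open>I\<close>.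
\<close>
lemma card_crossing:
  fixes A :: "'a set"
  assumes fin: "finite A" and k: "k > 0"
  shows "card {f \<in> A \<rightarrow>\<^sub>E {1..N}. \<exists>t\<le>N. num_below f A t + k \<le> t} =
    (\<Sum>I | I \<subseteq> A \<and> card I + k \<le> N. card (late_crossing k I) * (N - k - card I) ^ (card A - card I))"
proof -
  define B where "B I = {f \<in> A \<rightarrow>\<^sub>E {1..N}. {a \<in> A. f a \<le> k + card I} = I \<and> restrict f I \<in> late_crossing k I}"
    for I
  let ?\<I> = "{I. I \<subseteq> A \<and> card I + k \<le> N}"
  have nb: "num_below (restrict f I) I s = num_below f A s"
    if "{a \<in> A. f a \<le> t} = I" "s \<le> t" for f :: "'a \<Rightarrow> nat" and I s t
  proof -
    have "{a \<in> I. restrict f I a \<le> s} = {a \<in> A. f a \<le> s}" using that by auto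
    then show ?thesis by (simp add: num_below_def)
  qed
  have "{f \<in> A \<rightarrow>\<^sub>E {1..N}. \<exists>t\<le>N. num_below f A t + k \<le> t} = (\<Union>I\<in>?\<I>. B I)"
  proof (intro equalityI subsetI)
    fix f assume "f \<in> {f \<in> A \<rightarrow>\<^sub>E {1..N}. \<exists>t\<le>N. num_below f A t + k \<le> t}"
    then have f: "f \<in> A \<rightarrow>\<^sub>E {1..N}" and ex: "\<exists>t. t \<le> N \<and> num_below f A t + k \<le> t" by auto
    define t where "t = (LEAST t. t \<le> N \<and> num_below f A t + k \<le> t)"
    from LeastI_ex[OF ex] have t: "t \<le> N" "num_below f A t + k \<le> t" unfolding t_def by auto
    have before: "s < num_below f A s + k" if "s < t" for s
      using not_less_Least[of s "\<lambda>t. t \<le> N \<and> num_below f A t + k \<le> t"] that t(1)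
      unfolding t_def by linarith
    define I where "I = {a \<in> A. f a \<le> t}"
    have "t - 1 < num_below f A (t - 1) + k" using t(2) k by (intro before) auto
    then have "t \<le> num_below f A t + k" using num_below_mono[OF fin, of "t - 1" t f] by linarith
    then have tI: "k + card I = t" using t(2) by (simp add: I_def num_below_def)
    have "restrict f I \<in> I \<rightarrow>\<^sub>E {1..t}"
      using f by (auto simp: I_def restrict_PiE_iff)
    moreover have "s < num_below (restrict f I) I s + k" if "s < t" for s
      using before[OF that] nb[OF I_def[symmetric], of s] that by simp
    ultimately have "restrict f I \<in> late_crossing k I" by (simp add: late_crossing_def tI)
    then have "f \<in> B I" using f by (simp add: B_def tI I_def[symmetric])
    moreover have "I \<in> ?\<I>" using t(1) tI by (auto simp: I_def)
    ultimately show "f \<in> (\<Union>I\<in>?\<I>. B I)" by blast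
  next
    fix f assume "f \<in> (\<Union>I\<in>?\<I>. B I)"
    then obtain I where "f \<in> A \<rightarrow>\<^sub>E {1..N}" "card I + k \<le> N" "{a \<in> A. f a \<le> k + card I} = I"
      by (auto simp: B_def)
    then show "f \<in> {f \<in> A \<rightarrow>\<^sub>E {1..N}. \<exists>t\<le>N. num_below f A t + k \<le> t}"
      by (auto simp: num_below_def intro!: exI[of _ "k + card I"])
  qed
  moreover have "card (\<Union>I\<in>?\<I>. B I) = (\<Sum>I\<in>?\<I>. card (B I))"
  proof (rule card_UN_disjoint)
    show "finite ?\<I>" using fin by simp
    show "\<forall>I\<in>?\<I>. finite (B I)"
      using fin by (auto simp: B_def intro!: finite_subset[OF _ finite_PiE[of A "\<lambda>_. {1..N}"]])
    \<comment> \<open>An earlier crossing of \<open>f\<close> with set \<open>I\<close> would contradict that \<open>J\<close> belongs to the first one.\<close>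
    have le: "card J \<le> card I" if "f \<in> B I" "f \<in> B J" for f I J
    proof (rule ccontr)
      assume "\<not> card J \<le> card I"
      then have lt: "k + card I < k + card J" by simp
      have I: "{a \<in> A. f a \<le> k + card I} = I" and J: "{a \<in> A. f a \<le> k + card J} = J"
        and g: "restrict f J \<in> late_crossing k J"
        using that by (auto simp: B_def)
      have "k + card I < num_below (restrict f J) J (k + card I) + k"
        using g lt by (simp add: late_crossing_def)
      also have "num_below (restrict f J) J (k + card I) = card I"
        using nb[OF J, of "k + card I"] lt I by (simp add: num_below_def)
      finally show False by simp
    qed
    show "\<forall>I\<in>?\<I>. \<forall>J\<in>?\<I>. I \<noteq> J \<longrightarrow> B I \<inter> B J = {}"
    proof (intro ballI impI, rule ccontr)
      fix I J assume "I \<noteq> J" "B I \<inter> B J \<noteq> {}"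
      then obtain f where f: "f \<in> B I" "f \<in> B J" by blast
      then have "card I = card J" using le by (meson le_antisym)
      moreover have "{a \<in> A. f a \<le> k + card I} = I" "{a \<in> A. f a \<le> k + card J} = J"
        using f by (auto simp: B_def)
      ultimately show False using \<open>I \<noteq> J\<close> by simp
    qed
  qed
  moreover have "(\<Sum>I\<in>?\<I>. card (B I)) =
     (\<Sum>I\<in>?\<I>. card (late_crossing k I) * (N - k - card I) ^ (card A - card I))"
    unfolding B_def by (rule sum.cong[OF refl], rule card_first_crossing[OF fin]) simp_all
  ultimately show ?thesis by simp
qed

text \<open>
  With \<open>k + card A\<close> spaces every assignment crosses, at the latest at the last space. The sum in
  \<open>card_crossing\<close> then counts all assignments, and its term for \<open>I = A\<close> is the number wanted. The
  other terms are known by induction, and Abel's identity with \<open>x = k\<close> and \<open>y = card A\<close> has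
  the same terms, grouped by the cardinality of \<open>I\<close>.
\<close>
lemma card_late_crossing:
  assumes "finite A" "k > 0"
  shows "real (card (late_crossing k A)) = abel_weight (real k) (card A)"
  using assms(1)
proof (induction "card A" arbitrary: A rule: less_induct)
  case less
  let ?m = "card A" let ?N = "k + card A"
  let ?G = "\<lambda>i. abel_weight (real k) i * (real ?m - real i) ^ (?m - i)"
  note fin = less.prems
  have "num_below f A ?N + k \<le> ?N" for f using num_below_le[OF fin, of f ?N] by simp
  then have "{f \<in> A \<rightarrow>\<^sub>E {1..?N}. \<exists>t\<le>?N. num_below f A t + k \<le> t} = A \<rightarrow>\<^sub>E {1..?N}" by blast
  then have "?N ^ ?m = (\<Sum>I | I \<subseteq> A \<and> card I + k \<le> ?N. card (late_crossing k I) * (?N - k - card I) ^ (?m - card I))"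
    using card_crossing[OF fin assms(2), of ?N] fin by (simp add: card_PiE)
  also have "{I. I \<subseteq> A \<and> card I + k \<le> ?N} = insert A {I. I \<subset> A}"
    using card_mono[OF fin] by auto
  also have "(\<Sum>I\<in>insert A {I. I \<subset> A}. card (late_crossing k I) * (?N - k - card I) ^ (?m - card I)) =
      card (late_crossing k A) + (\<Sum>I | I \<subset> A. card (late_crossing k I) * (?m - card I) ^ (?m - card I))"
    using fin by (subst sum.insert) (auto intro: finite_subset[of _ "Pow A"])
  finally have "real ?N ^ ?m = real (card (late_crossing k A)) +
      (\<Sum>I | I \<subset> A. real (card (late_crossing k I)) * real (?m - card I) ^ (?m - card I))"
    by (simp flip: of_nat_power of_nat_mult of_nat_sum of_nat_add)
  also have "(\<Sum>I | I \<subset> A. real (card (late_crossing k I)) * real (?m - card I) ^ (?m - card I)) =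
      (\<Sum>I | I \<subset> A. ?G (card I))"
  proof (rule sum.cong)
    fix I assume "I \<in> {I. I \<subset> A}"
    then have "card I < ?m" "finite I" using psubset_card_mono[OF fin] fin by (auto intro: finite_subset)
    then show "real (card (late_crossing k I)) * real (?m - card I) ^ (?m - card I) = ?G (card I)"
      using less.hyps by (simp add: of_nat_diff)
  qed simp
  finally have 1: "real ?N ^ ?m = real (card (late_crossing k A)) + (\<Sum>I | I \<subset> A. ?G (card I))" .
  have "real ?N ^ ?m = (\<Sum>i\<le>?m. real (?m choose i) * abel_weight (real k) i * (real ?m - real i) ^ (?m - i))"
    using Abel_binomial[of ?m "real k" "real ?m"] by simp
  also have "\<dots> = (\<Sum>I | I \<subseteq> A. ?G (card I))"
    using sum_subsets_by_card[OF fin, where P = "\<lambda>_. True" and g = ?G] by (simp add: atMost_def mult_ac)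
  also have "{I. I \<subseteq> A} = insert A {I. I \<subset> A}" by auto
  also have "(\<Sum>I\<in>insert A {I. I \<subset> A}. ?G (card I)) = abel_weight (real k) ?m + (\<Sum>I | I \<subset> A. ?G (card I))"
    using fin by (subst sum.insert) (auto intro: finite_subset[of _ "Pow A"])
  finally show ?case using 1 by simp
qed

text \<open>
  For index \<open>0\<close> the integer exponent \<open>-1\<close> cancels the factor \<open>k\<close>, in agreement with the value \<open>1\<close> of the
  weight. In the range of summation the truncated subtraction is exact.
\<close>
lemma S_eq_sum_abel_weight:
  assumes "k > 0"
  shows "S n n k = (\<Sum>i | i + k \<le> n. real (n choose i) * abel_weight (real k) i * real (n - k - i) ^ (n - i))"
proof -
  have w: "real k * (real k + real i) powi (int i - 1) = abel_weight (real k) i" for i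
    using assms by (cases i) (auto simp: abel_weight_def power_int_minus)
  have "S n n k = (\<Sum>i | i + k \<le> n. real (n choose i) * real k * (real k + real i) powi (int i - 1)
      * (real n - real k - real i) ^ (n - i))"
    using assms by (simp add: S_def)
  also have "\<dots> = (\<Sum>i | i + k \<le> n. real (n choose i) * abel_weight (real k) i * real (n - k - i) ^ (n - i))"
  proof (rule sum.cong[OF refl])
    fix i assume "i \<in> {i. i + k \<le> n}"
    then have d: "real n - real k - real i = real (n - k - i)" by (simp add: of_nat_diff)
    show "real (n choose i) * real k * (real k + real i) powi (int i - 1) * (real n - real k - real i) ^ (n - i)
        = real (n choose i) * abel_weight (real k) i * real (n - k - i) ^ (n - i)"
      unfolding d w[symmetric] by (simp only: mult.assoc)
  qed
  finally show ?thesis .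
qed

theorem prob_at_least_fail_eq_S:
  assumes "n > 0"
  shows "prob_at_least_fail n n k = S n n k / real n ^ n"
proof -
  let ?F = "{f. k \<le> card (failing_drivers n n f)}"
  have fin: "finite (assignments n n)" and card: "card (assignments n n) = n ^ n"
    by (auto simp: assignments_def card_PiE intro!: finite_PiE)
  have ne: "assignments n n \<noteq> {}" using card assms by (metis card.empty power_not_zero not_less0)
  have prob: "prob_at_least_fail n n k = real (card (assignments n n \<inter> ?F)) / real n ^ n"
    unfolding prob_at_least_fail_def by (simp add: measure_pmf_of_set[OF ne fin] card)
  show ?thesis
  proof (cases "k = 0")
    case True
    then show ?thesis unfolding prob using assms by (simp add: card S_def)
  next
    case False
    then have k: "k > 0" by simp
    have "assignments n n \<inter> ?F = {f \<in> {1..n} \<rightarrow>\<^sub>E {1..n}. \<exists>t\<le>n. num_below f {1..n} t + k \<le> t}"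
      using at_least_fail_iff_crossing[OF _ k, of _ n] by (auto simp: assignments_def)
    then have "real (card (assignments n n \<inter> ?F)) = (\<Sum>I | I \<subseteq> {1..n} \<and> card I + k \<le> n.
        real (card (late_crossing k I)) * real (n - k - card I) ^ (n - card I))"
      using card_crossing[of "{1..n}" k n] k by simp
    also have "\<dots> = (\<Sum>I | I \<subseteq> {1..n} \<and> card I + k \<le> n.
        abel_weight (real k) (card I) * real (n - k - card I) ^ (n - card I))"
      by (rule sum.cong) (auto simp: card_late_crossing k finite_subset)
    also have "\<dots> = (\<Sum>i | i \<le> n \<and> i + k \<le> n. real (n choose i) *
        (abel_weight (real k) i * real (n - k - i) ^ (n - i)))"
      using sum_subsets_by_card[of "{1..n}", where P = "\<lambda>i. i + k \<le> n"
        and g = "\<lambda>i. abel_weight (real k) i * real (n - k - i) ^ (n - i)"] by simp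
    also have "{i. i \<le> n \<and> i + k \<le> n} = {i. i + k \<le> n}" by auto
    finally show ?thesis by (simp add: prob S_eq_sum_abel_weight[OF k] mult.assoc)
  qed
qed

section \<open>Bounds of Stirling type\<close>

text \<open>
  The quotient of \<open>n!\<close> and \<open>n\<^sup>n e\<^sup>-\<^sup>n \<surd>n\<close>, which by Stirling's formula converges to
  \<open>\<surd>(2 \<pi>)\<close>. It is enough to know that it decreases and stays above \<open>1\<close>.
\<close>
definition stirling_ratio :: "nat \<Rightarrow> real" where
  "stirling_ratio n = fact n * exp (real n) / (real n ^ n * sqrt (real n))"

lemma stirling_ratio_pos: "n > 0 \<Longrightarrow> stirling_ratio n > 0"
  by (simp add: stirling_ratio_def)

lemma ln_stirling_ratio_Suc:
  assumes "n > 0"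
  shows "ln (stirling_ratio n) - ln (stirling_ratio (Suc n)) =
         (real n + 1/2) * (ln (real n + 1) - ln (real n)) - 1"
proof -
  have L: "ln (stirling_ratio m) = ln (fact m) + real m - real m * ln (real m) - ln (real m) / 2" if "m > 0" for m
    using that by (simp add: stirling_ratio_def ln_mult ln_div ln_realpow ln_sqrt)
  have "ln (fact (Suc n) :: real) = ln (real n + 1) + ln (fact n)"
    by (simp add: ln_mult add.commute)
  then show ?thesis using assms by (simp add: L) (simp add: algebra_simps)
qed

text \<open>
  This is the midpoint bound for \<open>ln (n + 1) - ln n\<close> as the integral of \<open>1 / x\<close>.
\<close>
lemma stirling_ratio_Suc_le:
  assumes "n > 0"
  shows "stirling_ratio (Suc n) \<le> stirling_ratio n"
proof -
  have "ln (real n + 1) - ln (real n) \<ge> 2 * (real n + 1 - real n) / (real n + (real n + 1))"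
    using assms by (intro ln_inverse_approx_ge) auto
  then have "ln (real n + 1) - ln (real n) \<ge> 1 / (real n + 1/2)"
    by (simp add: field_simps)
  then have "(real n + 1/2) * (ln (real n + 1) - ln (real n)) \<ge> 1"
    by (simp add: pos_divide_le_eq mult.commute)
  then have "ln (stirling_ratio (Suc n)) \<le> ln (stirling_ratio n)"
    using ln_stirling_ratio_Suc[OF assms] by linarith
  then show ?thesis using stirling_ratio_pos assms by simp
qed

lemma stirling_ratio_antimono:
  assumes "0 < m" "m \<le> n"
  shows "stirling_ratio n \<le> stirling_ratio m"
  using assms(2)
proof (induction rule: dec_induct)
  case (step i)
  then show ?case using stirling_ratio_Suc_le[of i] assms(1) by linarith
qed simp

text \<open>
  The trapezoid bound for the same integral shows that the logarithm of the quotient loses at most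
  \<open>1 / (4 n) - 1 / (4 (n + 1))\<close> in each step. These losses telescope, and the logarithm starts at \<open>1\<close>
  for \<open>n = 1\<close>.
\<close>
lemma stirling_ratio_ge_1:
  assumes "n > 0"
  shows "stirling_ratio n \<ge> 1"
proof -
  have "ln (stirling_ratio n) - 1 / (4 * real n) \<ge> 3/4"
    using assms
  proof (induction n rule: nat_induct_non_zero)
    case 1
    then show ?case by (simp add: stirling_ratio_def)
  next
    case (Suc n)
    have n: "real n > 0" using Suc by simp
    have "ln (real n + 1) - ln (real n) \<le> 1 * (inverse (real n) + inverse (real n + 1)) / 2"
      using n by (intro ln_inverse_approx_le) auto
    then have "(real n + 1/2) * (ln (real n + 1) - ln (real n)) - 1
        \<le> (real n + 1/2) * ((inverse (real n) + inverse (real n + 1)) / 2) - 1"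
      using n by (intro diff_mono mult_left_mono) auto
    also have "\<dots> = 1 / (4 * real n) - 1 / (4 * real (Suc n))"
    proof -
      have "inverse (real n) + inverse (real n + 1) = (2 * real n + 1) / (real n * (real n + 1))"
        using n by (simp add: field_simps)
      moreover have "1 / (4 * real n) - 1 / (4 * real (Suc n)) = 1 / (4 * (real n * (real n + 1)))"
        using n by (simp add: divide_simps)
      moreover have "(real n + 1/2) * ((2 * real n + 1) / (real n * (real n + 1)) / 2) - 1
          = 1 / (4 * (real n * (real n + 1)))"
        using n by (simp add: divide_simps) (simp add: algebra_simps)
      ultimately show ?thesis by simp
    qed
    finally show ?case using Suc.IH ln_stirling_ratio_Suc[of n] Suc.hyps by linarith
  qed
  moreover have "1 / (4 * real n) \<ge> 0" by simp
  ultimately have "ln (stirling_ratio n) \<ge> 0" by linarith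
  then have "ln (stirling_ratio n) \<ge> ln 1" by simp
  then show ?thesis using stirling_ratio_pos[OF assms] by simp
qed

text \<open>
  The left-hand side is the probability of \<open>i\<close> successes in \<open>n\<close> trials with success probability
  \<open>i / n\<close>. Expressed by \<open>stirling_ratio\<close>, it is the right-hand side times
  \<open>stirling_ratio n / (stirling_ratio i * stirling_ratio (n - i))\<close>. Here the numerator is at most the first
  factor of the denominator, because the ratio decreases, and the second factor is at least \<open>1\<close>.
\<close>
lemma binomial_mode_le:
  assumes "0 < i" "i < n"
  shows "real (n choose i) * real i ^ i * real (n - i) ^ (n - i) / real n ^ n
         \<le> sqrt (real n / (real i * real (n - i)))"
proof -
  define j where "j = n - i"
  have j: "j > 0" "n = i + j" using assms by (auto simp: j_def)
  have eq: "fact m = stirling_ratio m * (real m ^ m * sqrt (real m)) / exp (real m)" if "m > 0" for m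
    using that by (simp add: stirling_ratio_def field_simps)
  have "real (n choose i) = fact n / (fact i * fact j)"
    using assms by (simp add: binomial_fact j_def)
  also have "\<dots> = stirling_ratio n / (stirling_ratio i * stirling_ratio j) *
      (real n ^ n * sqrt (real n)) / ((real i ^ i * sqrt (real i)) * (real j ^ j * sqrt (real j)))"
    using assms j stirling_ratio_pos[of i] stirling_ratio_pos[of j]
    by (simp add: eq exp_add field_simps)
  finally have "real (n choose i) * real i ^ i * real j ^ j / real n ^ n =
      stirling_ratio n / (stirling_ratio i * stirling_ratio j) * sqrt (real n / (real i * real j))"
    using assms j by (simp add: field_simps real_sqrt_divide real_sqrt_mult)
  also have "\<dots> \<le> 1 * sqrt (real n / (real i * real j))"
  proof (rule mult_right_mono)
    have "stirling_ratio n * 1 \<le> stirling_ratio i * stirling_ratio j"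
      using assms j stirling_ratio_pos[of n] stirling_ratio_pos[of i]
      by (intro mult_mono stirling_ratio_antimono stirling_ratio_ge_1) auto
    then show "stirling_ratio n / (stirling_ratio i * stirling_ratio j) \<le> 1"
      using assms j stirling_ratio_pos[of i] stirling_ratio_pos[of j] by (simp add: divide_le_eq)
  qed simp
  finally show ?thesis by (simp add: j_def)
qed

lemma sqrt_parts_le:
  assumes "0 < i" "i < n"
  shows "sqrt (real n / (real i * real (n - i))) \<le> 1 / sqrt (real i) + 1 / sqrt (real (n - i))"
proof -
  have "real n / (real i * real (n - i)) = 1 / real i + 1 / real (n - i)"
    using assms by (simp add: field_simps of_nat_diff)
  then show ?thesis
    using sqrt_add_le_add_sqrt[of "1 / real i" "1 / real (n - i)"] by (simp add: real_sqrt_divide)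
qed

lemma sum_inverse_sqrt_le: "(\<Sum>i=1..n. 1 / sqrt (real i)) \<le> 2 * sqrt (real n)"
proof (induction n)
  case (Suc n)
  have pos: "sqrt (real (Suc n)) > 0" by simp
  have "2 * sqrt (real n) * sqrt (real (Suc n)) \<le> real n + real (Suc n)"
    using sum_squares_bound[of "sqrt (real n)" "sqrt (real (Suc n))"] by simp
  moreover have "sqrt (real (Suc n)) * sqrt (real (Suc n)) = real n + 1" by simp
  ultimately have "(2 * sqrt (real n)) * sqrt (real (Suc n)) + 1 \<le> 2 * sqrt (real (Suc n)) * sqrt (real (Suc n))"
    by (simp add: algebra_simps)
  then have "2 * sqrt (real n) + 1 / sqrt (real (Suc n)) \<le> 2 * sqrt (real (Suc n))"
    using pos by (simp add: field_simps)
  then show ?case using Suc by simp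
qed simp

lemma sum_binomial_mode_le:
  assumes "n > 0"
  shows "(\<Sum>i=1..n-1. sqrt (real n / (real i * real (n - i)))) \<le> 4 * sqrt (real n)"
proof -
  have "(\<Sum>i=1..n-1. sqrt (real n / (real i * real (n - i)))) \<le>
        (\<Sum>i=1..n-1. 1 / sqrt (real i) + 1 / sqrt (real (n - i)))"
    using assms by (intro sum_mono sqrt_parts_le) auto
  also have "\<dots> = (\<Sum>i=1..n-1. 1 / sqrt (real i)) + (\<Sum>i=1..n-1. 1 / sqrt (real (n - i)))"
    by (rule sum.distrib)
  also have "(\<Sum>i=1..n-1. 1 / sqrt (real (n - i))) = (\<Sum>i=1..n-1. 1 / sqrt (real i))"
    using assms by (intro sum.reindex_bij_witness[of _ "\<lambda>i. n - i" "\<lambda>i. n - i"]) auto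
  finally have "(\<Sum>i=1..n-1. sqrt (real n / (real i * real (n - i)))) \<le> 4 * sqrt (real (n - 1))"
    using sum_inverse_sqrt_le[of "n - 1"] by simp
  also have "\<dots> \<le> 4 * sqrt (real n)" by simp
  finally show ?thesis .
qed

text \<open>
  The second-order term comes from the trapezoid bound for \<open>ln (i + k) - ln i\<close>. It produces the
  Gaussian decay in \<open>k / \<surd>n\<close>.
\<close>
lemma one_plus_div_power_le:
  assumes "0 < i" "0 < k"
  shows "(1 + real k / real i) ^ i \<le> exp (real k - (real k)\<^sup>2 / (2 * (real i + real k)))"
proof -
  have "ln (real i + real k) - ln (real i) \<le> real k * (inverse (real i) + inverse (real i + real k)) / 2"
    using assms by (intro ln_inverse_approx_le) auto
  moreover have "ln (1 + real k / real i) = ln (real i + real k) - ln (real i)"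
  proof -
    have "1 + real k / real i = (real i + real k) / real i" using assms by (simp add: field_simps)
    then show ?thesis using assms by (simp add: ln_div)
  qed
  ultimately have "real i * ln (1 + real k / real i) \<le>
      real i * (real k * (inverse (real i) + inverse (real i + real k)) / 2)"
    by (intro mult_left_mono) auto
  also have "\<dots> = real k - (real k)\<^sup>2 / (2 * (real i + real k))"
    using assms by (simp add: divide_simps power2_eq_square) (simp add: algebra_simps)
  finally have "exp (real i * ln (1 + real k / real i)) \<le> exp (real k - (real k)\<^sup>2 / (2 * (real i + real k)))"
    by simp
  moreover have "exp (real i * ln (1 + real k / real i)) = (1 + real k / real i) ^ i"
    using assms by (subst exp_of_nat_mult) (simp add: add_pos_nonneg)
  ultimately show ?thesis by simp
qed

lemma one_minus_div_power_le:
  assumes "k \<le> m"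
  shows "(1 - real k / real m) ^ m \<le> exp (- real k)"
proof (cases "m = 0")
  case False
  have "(1 - real k / real m) ^ m \<le> exp (- real k / real m) ^ m"
    using assms False exp_ge_add_one_self[of "- real k / real m"]
    by (intro power_mono) (auto simp: field_simps)
  also have "\<dots> = exp (- real k)"
    using False by (simp flip: exp_of_nat_mult)
  finally show ?thesis .
qed (use assms in simp)

lemma exp_minus_le_inverse:
  fixes x :: real
  assumes "x > 0"
  shows "exp (- x) \<le> 1 / x"
proof -
  have "x \<le> exp x" using exp_ge_add_one_self[of x] by linarith
  then show ?thesis using assms by (simp add: exp_minus field_simps)
qed

section \<open>Bounds for the probability\<close>

text \<open>
  Splitting off \<open>i\<^sup>i\<close> prepares the weight for \<open>binomial_mode_le\<close>.
\<close>
lemma abel_weight_eq_power: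
  assumes "i > 0"
  shows "abel_weight (real k) i = real k / (real k + real i) * (1 + real k / real i) ^ i * real i ^ i"
proof -
  have "(1 + real k / real i) ^ i * real i ^ i = (real k + real i) ^ i"
    using assms by (simp add: power_mult_distrib[symmetric] field_simps)
  also have "\<dots> = (real k + real i) * (real k + real i) ^ (i - 1)"
    using assms by (cases i) simp_all
  finally show ?thesis
    using assms by (simp add: abel_weight_def mult.assoc)
qed

lemma S_nonneg: "S n n k \<ge> 0"
  by (cases "k = 0") (auto simp: S_def[of n n 0] S_eq_sum_abel_weight abel_weight_def intro!: sum_nonneg)

text \<open>
  The summand for \<open>i = 0\<close> is at most \<open>exp (- k)\<close>. In the others the factors \<open>exp k\<close> and
  \<open>exp (- k)\<close> cancel, and the remaining \<open>exp (- k\<^sup>2 / (2 (i + k)))\<close> is bounded by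
  \<open>2 (i + k) / k\<^sup>2\<close>. This crude bound is chosen because it cancels the factor \<open>k / (k + i)\<close> and so
  removes \<open>i\<close> from everything except the binomial weight.
\<close>
lemma S_ratio_le:
  assumes k: "k > 0"
  shows "S n n k / real n ^ n \<le> 9 * sqrt (real n) / real k"
proof (cases "k \<le> n")
  case False
  then have "{i. i + k \<le> n} = {}" by auto
  then show ?thesis using k by (simp add: S_eq_sum_abel_weight)
next
  case kn: True
  define T where "T i = real (n choose i) * abel_weight (real k) i * real (n - k - i) ^ (n - i) / real n ^ n" for i
  define Q where "Q i = sqrt (real n / (real i * real (n - i)))" for i
  have n: "n > 0" using k kn by simp
  have T0: "T 0 \<le> sqrt (real n) / real k"
  proof -
    have "T 0 = (1 - real k / real n) ^ n"
      using n kn by (simp add: T_def abel_weight_def of_nat_diff power_divide[symmetric] diff_divide_distrib)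
    also have "\<dots> \<le> exp (- real k)" by (rule one_minus_div_power_le) fact
    also have "\<dots> \<le> 1 / real k" using k by (intro exp_minus_le_inverse) simp
    also have "\<dots> \<le> sqrt (real n) / real k" using n by (intro divide_right_mono) auto
    finally show ?thesis .
  qed
  have Ti: "T i \<le> 2 / real k * Q i" if i: "i \<in> {1..n - k}" for i
  proof -
    have i0: "0 < i" and i1: "i < n" and ik: "k \<le> n - i" using i k kn by auto
    let ?M = "real (n choose i) * real i ^ i * real (n - i) ^ (n - i) / real n ^ n"
    let ?c = "real k / (real k + real i)"
    let ?p = "(1 + real k / real i) ^ i" and ?q = "(1 - real k / real (n - i)) ^ (n - i)"
    have "real (n - k - i) ^ (n - i) = ?q * real (n - i) ^ (n - i)"
    proof -
      have "real (n - k - i) = (1 - real k / real (n - i)) * real (n - i)"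
        using i1 ik by (simp add: left_diff_distrib of_nat_diff)
      then show ?thesis by (simp only: power_mult_distrib)
    qed
    then have "T i = ?M * (?c * (?p * ?q))"
      by (simp add: T_def abel_weight_eq_power[OF i0] mult_ac)
    also have "\<dots> \<le> Q i * (?c * (exp (real k - (real k)\<^sup>2 / (2 * (real i + real k))) * exp (- real k)))"
      unfolding Q_def using i0 i1 ik k
      by (intro mult_mono binomial_mode_le one_plus_div_power_le one_minus_div_power_le) auto
    also have "exp (real k - (real k)\<^sup>2 / (2 * (real i + real k))) * exp (- real k) =
        exp (- ((real k)\<^sup>2 / (2 * (real i + real k))))"
      by (simp flip: exp_add)
    also have "Q i * (?c * exp (- ((real k)\<^sup>2 / (2 * (real i + real k))))) \<le>
        Q i * (?c * (1 / ((real k)\<^sup>2 / (2 * (real i + real k)))))"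
      using k i0 by (intro mult_left_mono exp_minus_le_inverse) (auto simp: Q_def)
    also have "?c * (1 / ((real k)\<^sup>2 / (2 * (real i + real k)))) = 2 / real k"
      using k i0 by (simp add: divide_simps power2_eq_square)
    finally show ?thesis by (simp add: mult.commute)
  qed
  have "(\<Sum>i=1..n-k. T i) \<le> (\<Sum>i=1..n-k. 2 / real k * Q i)"
    by (rule sum_mono) (fact Ti)
  also have "\<dots> \<le> (\<Sum>i=1..n-1. 2 / real k * Q i)"
    using k by (intro sum_mono2) (auto simp: Q_def)
  also have "\<dots> = 2 / real k * (\<Sum>i=1..n-1. Q i)"
    by (rule sum_distrib_left[symmetric])
  also have "\<dots> \<le> 2 / real k * (4 * sqrt (real n))"
    unfolding Q_def by (intro mult_left_mono sum_binomial_mode_le n) auto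
  finally have rest: "(\<Sum>i=1..n-k. T i) \<le> 8 * sqrt (real n) / real k" by simp
  have "{i. i + k \<le> n} = insert 0 {1..n - k}" using kn by auto
  then have "S n n k / real n ^ n = T 0 + (\<Sum>i=1..n-k. T i)"
    by (simp add: S_eq_sum_abel_weight[OF k] T_def sum_divide_distrib add_divide_distrib)
  also have "\<dots> \<le> 9 * sqrt (real n) / real k" using T0 rest by simp
  finally show ?thesis .
qed

text \<open>
  Lowering the upper index from \<open>p\<close> to \<open>p - 1\<close> multiplies the binomial coefficient by
  \<open>(p - i) / p\<close>, and this is at most \<open>(n - i) / n\<close> for \<open>p \<le> n\<close>.
\<close>
lemma binomial_remove_le:
  assumes "k + i \<le> n"
  shows "((n - k) choose i) * n ^ k \<le> (n choose i) * (n - i) ^ k"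
  using assms
proof (induction k)
  case (Suc k)
  let ?p = "n - k"
  have p: "?p > 0" "i \<le> ?p" "n - Suc k = ?p - 1" "?p \<le> n" using Suc.prems by auto
  have "?p * n - i * n \<le> ?p * n - i * ?p"
    using p(4) by (intro diff_le_mono2 mult_le_mono) auto
  then have step: "(?p - i) * n \<le> (n - i) * ?p"
    by (simp only: diff_mult_distrib mult.commute[of n ?p])
  have "?p * ((?p - 1 choose i) * n ^ Suc k) = (?p * (?p - 1 choose i)) * (n ^ k * n)"
    by (simp only: power_Suc2 mult.assoc)
  also have "\<dots> = ((?p - i) * (?p choose i)) * (n ^ k * n)"
    by (subst binomial_absorb_comp[of ?p i]) (rule refl)
  also have "\<dots> = ((?p choose i) * n ^ k) * ((?p - i) * n)"
    by (simp only: mult_ac)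
  also have "\<dots> \<le> ((n choose i) * (n - i) ^ k) * ((n - i) * ?p)"
  proof (rule mult_le_mono)
    show "(?p choose i) * n ^ k \<le> (n choose i) * (n - i) ^ k"
      using Suc.prems by (intro Suc.IH) simp
  qed (fact step)
  also have "\<dots> = ?p * ((n choose i) * (n - i) ^ Suc k)"
    by (simp only: power_Suc2 mult_ac)
  finally have "?p * ((?p - 1 choose i) * n ^ Suc k) \<le> ?p * ((n choose i) * (n - i) ^ Suc k)" .
  then have "(?p - 1 choose i) * n ^ Suc k \<le> (n choose i) * (n - i) ^ Suc k"
    using p(1) by (simp only: mult_le_cancel1)
  then show ?case unfolding p(3) .
qed simp

text \<open>
  Here \<open>(1 + k / i)\<^sup>i \<le> exp k\<close> and \<open>(m / n)\<^sup>m \<le> exp (- k m / n)\<close>. Since \<open>m = n - k\<close>, their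
  product is at most \<open>exp (k\<^sup>2 / n) \<le> exp 1 \<le> 3\<close>.
\<close>
lemma Abel_summand_le:
  assumes k: "k > 0" and i: "0 < i" "i < m" and n: "n = m + k" and kk: "k * k \<le> n"
  shows "real (m choose i) * abel_weight (real k) i * real (m - i) ^ (m - i) / real n ^ m
         \<le> 3 * real k / (real k + real i) * sqrt (real m / (real i * real (m - i)))"
proof -
  let ?M = "real (m choose i) * real i ^ i * real (m - i) ^ (m - i) / real m ^ m"
  let ?c = "real k / (real k + real i)"
  let ?p = "(1 + real k / real i) ^ i" and ?q = "(real m / real n) ^ m"
  let ?Q = "sqrt (real m / (real i * real (m - i)))"
  have n0: "n > 0" and mn: "real m = real n - real k" using n k by simp_all
  have q: "?q / real m ^ m = 1 / real n ^ m"
    using i by (simp add: power_divide)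
  have "real (m choose i) * abel_weight (real k) i * real (m - i) ^ (m - i) / real n ^ m =
      real (m choose i) * (?c * ?p * real i ^ i) * real (m - i) ^ (m - i) * (1 / real n ^ m)"
    by (simp add: abel_weight_eq_power[OF i(1)])
  also have "\<dots> = ?M * (?c * (?p * ?q))"
    unfolding q[symmetric] by (simp only: divide_inverse mult_ac)
  also have "\<dots> \<le> ?Q * (?c * 3)"
  proof (intro mult_mono)
    show "?M \<le> ?Q" using i by (intro binomial_mode_le)
    have "?p \<le> exp (real k)"
      by (rule order.trans[OF one_plus_div_power_le[OF i(1) k]]) simp
    moreover have "?q \<le> exp (- real k / real n) ^ m"
    proof (rule power_mono)
      have "real m / real n = 1 + - real k / real n" using n0 by (simp add: mn diff_divide_distrib)
      then show "real m / real n \<le> exp (- real k / real n)"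
        using exp_ge_add_one_self[of "- real k / real n"] by simp
    qed simp
    ultimately have "?p * ?q \<le> exp (real k) * exp (- real k / real n) ^ m"
      by (intro mult_mono) auto
    also have "\<dots> = exp (real k + real m * (- real k / real n))"
      by (simp only: exp_of_nat_mult exp_add)
    also have "real k + real m * (- real k / real n) = real (k * k) / real n"
      using n0 by (simp add: mn field_simps)
    also have "exp (real (k * k) / real n) \<le> exp 1"
      using kk n0 by (simp del: of_nat_mult)
    also have "\<dots> \<le> 3" by (rule exp_le)
    finally show "?p * ?q \<le> 3" .
  qed auto
  finally show ?thesis by (simp add: mult_ac)
qed

text \<open>
  Passing from \<open>m = n - k\<close> to \<open>n\<close> drivers multiplies the summand by at least
  \<open>((m - i) / (n - i))\<^sup>k\<close>: the other \<open>k\<close> drivers must avoid the first \<open>k + i\<close> spaces, while the gain in the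
  binomial coefficient makes up for a part of this. As \<open>n - i \<ge> n / 2\<close>, Bernoulli's
  inequality finishes the estimate.
\<close>
lemma S_summand_ge:
  assumes k: "k > 0" "2 * k \<le> n" and i: "2 * i \<le> n" and m: "n = m + k"
  shows "(1 - 2 * (real k)\<^sup>2 / real n) *
           (real (m choose i) * abel_weight (real k) i * real (m - i) ^ (m - i) / real n ^ m)
         \<le> real (n choose i) * abel_weight (real k) i * real (n - k - i) ^ (n - i) / real n ^ n"
    (is "_ * ?A \<le> ?T")
proof -
  have n: "n > 0" using k by simp
  have im: "i \<le> m" and ni: "n - i > 0" and nmi: "n - k - i = m - i" "n - i = (m - i) + k"
    using i k m by auto
  let ?r = "real (m - i) / real (n - i)"
  have "(m choose i) * n ^ k \<le> (n choose i) * (n - i) ^ k"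
    using binomial_remove_le[of k i n] im by (simp add: m)
  then have "real (m choose i) * real n ^ k \<le> real (n choose i) * real (n - i) ^ k"
    unfolding of_nat_mult[symmetric] of_nat_power[symmetric] of_nat_le_iff .
  then have "real (m choose i) / real (n - i) ^ k \<le> real (n choose i) / real n ^ k"
    using n ni by (simp add: field_simps)
  then have "real (m choose i) / real (n - i) ^ k *
        (abel_weight (real k) i * real (m - i) ^ (m - i) * real (m - i) ^ k / real n ^ m) \<le>
      real (n choose i) / real n ^ k *
        (abel_weight (real k) i * real (m - i) ^ (m - i) * real (m - i) ^ k / real n ^ m)"
    by (rule mult_right_mono) (simp add: abel_weight_def)
  also have "\<dots> = ?T"
    unfolding nmi by (simp add: m power_add mult_ac)
  also have "real (m choose i) / real (n - i) ^ k *
        (abel_weight (real k) i * real (m - i) ^ (m - i) * real (m - i) ^ k / real n ^ m) = ?r ^ k * ?A"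
    by (simp add: power_divide)
  finally have 1: "?r ^ k * ?A \<le> ?T" .
  have "1 - 2 * (real k)\<^sup>2 / real n = 1 + real k * (- 2 * real k / real n)"
    by (simp add: power2_eq_square)
  also have "\<dots> \<le> (1 + (- 2 * real k / real n)) ^ k"
    using n k(2) by (intro Bernoulli_inequality) (simp add: field_simps)
  also have "\<dots> \<le> ?r ^ k"
  proof (rule power_mono)
    show "0 \<le> 1 + (- 2 * real k / real n)" using n k(2) by (simp add: field_simps)
    have "real (m - i) = real (n - i) - real k" using nmi(2) by simp
    then have "?r = 1 - real k / real (n - i)" using ni by (simp add: diff_divide_distrib)
    moreover have "real k / real (n - i) \<le> real k / (real n / 2)"
      using i n by (intro divide_left_mono) (auto simp: of_nat_diff)
    ultimately show "1 + (- 2 * real k / real n) \<le> ?r" by (simp add: mult.commute)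
  qed
  finally have "(1 - 2 * (real k)\<^sup>2 / real n) * ?A \<le> ?r ^ k * ?A"
    by (rule mult_right_mono) (simp add: abel_weight_def)
  with 1 show ?thesis by linarith
qed

text \<open>
  For \<open>k > 0\<close> the bound is void unless \<open>25 k < \<surd>n\<close>, which provides the smallness of \<open>k\<close> that the estimates of
  the summands ask for. In the constant, \<open>24\<close> comes from the summands with \<open>n / 2 < i < n - k\<close>
  and \<open>1\<close> from the summand \<open>i = n - k\<close>.
\<close>
lemma S_ratio_ge:
  assumes n: "n > 0"
  shows "1 - 2 * (real k)\<^sup>2 / real n - 25 * real k / sqrt (real n) \<le> S n n k / real n ^ n"
proof (cases "k > 0 \<and> 25 * real k / sqrt (real n) < 1")
  case False
  have ge0: "S n n k / real n ^ n \<ge> 0" using S_nonneg by simp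
  have sq: "2 * (real k)\<^sup>2 / real n \<ge> 0" by simp
  consider "k = 0" | "25 * real k / sqrt (real n) \<ge> 1"
    using False by force
  then show ?thesis
  proof cases
    case 1
    then show ?thesis using n by (simp add: S_def)
  next
    case 2
    then show ?thesis using ge0 sq by linarith
  qed
next
  case True
  then have k: "k > 0" and "25 * real k < sqrt (real n)"
    using n by (auto simp: divide_less_eq)
  then have "(25 * real k)\<^sup>2 < (sqrt (real n))\<^sup>2" by (intro power_strict_mono) auto
  then have "625 * (real k * real k) < real n" by (simp add: power2_eq_square)
  then have kk: "k * k \<le> n" "4 * (k * k) \<le> n" by (simp_all flip: of_nat_mult)
  moreover have "k \<le> k * k" using k by simp
  ultimately have k4: "4 * k \<le> n" by linarith
  define m where "m = n - k"
  have m: "m > 0" "n = m + k" "k \<le> m" "m \<le> n" using k4 k by (auto simp: m_def)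
  define T where "T i = real (n choose i) * abel_weight (real k) i * real (n - k - i) ^ (n - i) / real n ^ n" for i
  define A where "A i = real (m choose i) * abel_weight (real k) i * real (m - i) ^ (m - i) / real n ^ m" for i
  define Q where "Q i = sqrt (real m / (real i * real (m - i)))" for i
  have nonneg: "T i \<ge> 0" "A i \<ge> 0" for i by (auto simp: T_def A_def abel_weight_def)
  have sumA: "(\<Sum>i\<le>m. A i) = 1"
  proof -
    have "(\<Sum>i\<le>m. real (m choose i) * abel_weight (real k) i * real (m - i) ^ (m - i)) =
        (\<Sum>i\<le>m. real (m choose i) * abel_weight (real k) i * (real m - real i) ^ (m - i))"
      by (rule sum.cong) (auto simp: of_nat_diff)
    also have "\<dots> = real n ^ m" unfolding Abel_binomial m(2) by (simp add: add.commute)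
    finally show ?thesis using n by (simp add: A_def sum_divide_distrib[symmetric])
  qed
  have TA: "(1 - 2 * (real k)\<^sup>2 / real n) * A i \<le> T i" if "2 * i \<le> n" for i
    unfolding A_def T_def by (rule S_summand_ge) (use that k k4 m(2) in auto)
  have A_tail: "A i \<le> 6 * real k / real n * Q i" if i: "n < 2 * i" "i < m" for i
  proof -
    have "A i \<le> 3 * real k / (real k + real i) * Q i"
      unfolding A_def Q_def by (rule Abel_summand_le) (use i k m(2) kk(1) in auto)
    also have "\<dots> \<le> 3 * real k / (real n / 2) * Q i"
      using i k n by (intro mult_right_mono divide_left_mono) (auto simp: Q_def)
    finally show ?thesis by (simp add: mult.commute)
  qed
  have A_last: "A m = real k / real n"
  proof -
    have "real n ^ m = real n * real n ^ (m - 1)" using m(1) by (cases m) simp_all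
    then have "A m = real k * real n ^ (m - 1) / (real n * real n ^ (m - 1))"
      using m(1) by (simp add: A_def abel_weight_def m(2) add.commute)
    then show ?thesis using n by simp
  qed
  let ?L = "{i. i \<le> m \<and> 2 * i \<le> n}" and ?R = "{i. i \<le> m \<and> n < 2 * i}"
  have tail: "sum A ?R \<le> 25 * real k / sqrt (real n)"
  proof -
    have nQ: "6 * real k / real n * Q i \<ge> 0" for i by (simp add: Q_def)
    have "sum A {i. i < m \<and> n < 2 * i} \<le> (\<Sum>i | i < m \<and> n < 2 * i. 6 * real k / real n * Q i)"
      by (rule sum_mono) (rule A_tail; simp)
    also have "\<dots> \<le> (\<Sum>i=1..m-1. 6 * real k / real n * Q i)"
      using nQ by (intro sum_mono2) auto
    also have "\<dots> = 6 * real k / real n * (\<Sum>i=1..m-1. Q i)"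
      by (rule sum_distrib_left[symmetric])
    also have "\<dots> \<le> 6 * real k / real n * (4 * sqrt (real m))"
      unfolding Q_def by (intro mult_left_mono sum_binomial_mode_le m) auto
    also have "\<dots> \<le> 6 * real k / real n * (4 * sqrt (real n))"
      using m(4) by (intro mult_left_mono) auto
    also have "\<dots> = 24 * real k / sqrt (real n)"
      using n by (simp add: field_simps real_sqrt_mult_self)
    finally have inner: "sum A {i. i < m \<and> n < 2 * i} \<le> 24 * real k / sqrt (real n)" .
    have "sqrt (real n) * 1 \<le> sqrt (real n) * sqrt (real n)"
      using n by (intro mult_left_mono) auto
    then have last: "A m \<le> real k / sqrt (real n)"
      unfolding A_last using n by (intro divide_left_mono) auto
    have "sum A ?R \<le> sum A (insert m {i. i < m \<and> n < 2 * i})"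
      using nonneg by (intro sum_mono2) auto
    also have "\<dots> = A m + sum A {i. i < m \<and> n < 2 * i}"
      by simp
    finally show ?thesis using inner last by simp
  qed
  have "{..m} = ?L \<union> ?R" by auto
  then have "(\<Sum>i\<le>m. A i) = sum A (?L \<union> ?R)" by simp
  also have "\<dots> = sum A ?L + sum A ?R" by (rule sum.union_disjoint) auto
  finally have LR: "sum A ?L = 1 - sum A ?R" using sumA by simp
  have "(2 * (real k)\<^sup>2 / real n) * sum A ?R \<ge> 0" using nonneg by (simp add: sum_nonneg)
  then have "1 - 2 * (real k)\<^sup>2 / real n - 25 * real k / sqrt (real n) \<le>
      (1 - 2 * (real k)\<^sup>2 / real n) * sum A ?L"
    using tail unfolding LR by (simp add: algebra_simps)
  also have "\<dots> \<le> sum T ?L"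
    unfolding sum_distrib_left by (rule sum_mono) (auto intro: TA)
  also have "\<dots> \<le> (\<Sum>i | i + k \<le> n. T i)"
    using nonneg m(2) by (intro sum_mono2) auto
  also have "\<dots> = S n n k / real n ^ n"
    by (simp add: S_eq_sum_abel_weight[OF k] T_def sum_divide_distrib)
  finally show ?thesis .
qed

section \<open>The two limits\<close>

theorem corollary9:
  fixes k :: "nat \<Rightarrow> nat"
  shows "(filterlim (\<lambda>n. real (k n) / sqrt (real n)) at_top sequentially \<longrightarrow>
            (\<lambda>n. prob_at_least_fail n n (k n)) \<longlonglongrightarrow> 0 \<and>
            (\<lambda>n. S n n (k n) / real n ^ n) \<longlonglongrightarrow> 0) \<and>
         ((\<lambda>n. real (k n) / sqrt (real n)) \<longlonglongrightarrow> 0 \<longrightarrow>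
            (\<lambda>n. prob_at_least_fail n n (k n)) \<longlonglongrightarrow> 1 \<and>
            (\<lambda>n. S n n (k n) / real n ^ n) \<longlonglongrightarrow> 1)"
proof -
  let ?x = "\<lambda>n. real (k n) / sqrt (real n)" and ?s = "\<lambda>n. S n n (k n) / real n ^ n"
  have eq: "\<forall>\<^sub>F n in sequentially. prob_at_least_fail n n (k n) = ?s n"
    using eventually_gt_at_top[of 0] by eventually_elim (rule prob_at_least_fail_eq_S)
  have "?s \<longlonglongrightarrow> 0" if x: "filterlim ?x at_top sequentially"
  proof (rule tendsto_sandwich)
    show "\<forall>\<^sub>F n in sequentially. 0 \<le> ?s n" by (simp add: S_nonneg)
    have "\<forall>\<^sub>F n in sequentially. ?x n > 0"
      using x by (simp add: filterlim_at_top_dense)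
    then show "\<forall>\<^sub>F n in sequentially. ?s n \<le> 9 * inverse (?x n)"
    proof eventually_elim
      case (elim n)
      then have "k n > 0" by (cases "k n = 0") auto
      then show ?case using S_ratio_le[of "k n" n] by (simp add: field_simps)
    qed
    show "(\<lambda>n. 9 * inverse (?x n)) \<longlonglongrightarrow> 0"
      by (intro tendsto_mult_right_zero tendsto_inverse_0_at_top x)
  qed simp
  moreover have "?s \<longlonglongrightarrow> 1" if x: "?x \<longlonglongrightarrow> 0"
  proof (rule tendsto_sandwich)
    show "\<forall>\<^sub>F n in sequentially. 1 - 2 * (?x n)\<^sup>2 - 25 * ?x n \<le> ?s n"
      using eventually_gt_at_top[of 0] by eventually_elim (use S_ratio_ge in \<open>simp add: power_divide\<close>)
    show "\<forall>\<^sub>F n in sequentially. ?s n \<le> 1"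
      using eq by eventually_elim (metis prob_at_least_fail_def measure_pmf.prob_le_1)
    have "(\<lambda>n. 1 - 2 * (?x n)\<^sup>2 - 25 * ?x n) \<longlonglongrightarrow> 1 - 2 * 0\<^sup>2 - 25 * 0"
      by (intro tendsto_intros x)
    then show "(\<lambda>n. 1 - 2 * (?x n)\<^sup>2 - 25 * ?x n) \<longlonglongrightarrow> 1" by simp
  qed simp
  ultimately show ?thesis
    using tendsto_cong[OF eq] by blast
qed

end
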